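(* Let $K\ge1$, $\hat\theta\in\mathbb R^K$ and $\gamma>0$. The problem $$\min_{p\in\Delta([K])}\ \sup_{\theta\in\mathbb R^K}\ \max_{a^*\in\{\mathbf e_1,\dots,\mathbf e_K\}}\ \langle\bar a_p-a^*,\theta\rangle-\frac\gamma4\|\hat\theta-\theta\|_{H_p}^2$$ has a unique minimizer $p$, and it coincides with the unique minimizer of the log-barrier problem $$\operatorname*{argmin}_{p\in\Delta([K])}\Big\{\langle p,\hat\theta\rangle-\frac1\gamma\sum_{a\in[K]}\log(p_a)\Big\}=\Big(\frac1{\lambda+\gamma\hat\theta_i}\Big)_{i=1}^K,$$ where $\lambda$ is the unique real number for which the weights on the right-hand side form a probability distribution (are positive and sum to one).
   Context: $\Delta([K])$ is the probability simplex on $[K]=\{1,\dots,K\}$, where $p\in\Delta([K])$ is identified with the distribution on standard basis vectors $\mathbf e_1,\dots,\mathbf e_K$ of $\mathbb R^K$ selecting $\mathbf e_i$ with probability $p_i$. $\bar a_p=\mathbb E_{a\sim p}[a]$, $H_p=\mathbb E_{a\sim p}[aa^\top]$, and $\|x\|_H^2=\langle x,Hx\rangle$. The supremum may be $+\infty$. *)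

theory Defs
  imports "HOL-Analysis.Analysis"
begin

text \<open>
  The index set $[K]$ is a finite type \<open>'n\<close> with \<open>K = CARD('n)\<close>; types are nonempty, so \<open>K \<ge> 1\<close>.
\<close>

definition prob_simplex :: "(real ^ 'n) set" where
  "prob_simplex = {p. (\<forall>i. 0 \<le> p $ i) \<and> (\<Sum>i\<in>UNIV. p $ i) = 1}"

definition std_basis :: "(real ^ 'n) set" where
  "std_basis = range (\<lambda>i. axis i 1)"

text \<open>
  Expectation of \<open>f a\<close> when \<open>a\<close> is the standard basis vector \<open>axis i 1\<close> with probability \<open>p $ i\<close>.
\<close>

definition expect :: "real ^ 'n \<Rightarrow> (real ^ 'n \<Rightarrow> 'b::real_vector) \<Rightarrow> 'b" where
  "expect p f = (\<Sum>i\<in>UNIV. p $ i *\<^sub>R f (axis i 1))"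

definition mean_action :: "real ^ 'n \<Rightarrow> real ^ 'n" where
  "mean_action p = expect p (\<lambda>a. a)"

definition second_moment :: "real ^ 'n \<Rightarrow> real ^ 'n ^ 'n" where
  "second_moment p = expect p (\<lambda>a. (columnvector a :: real ^ 1 ^ 'n) ** rowvector a)"

definition sq_norm_wrt :: "real ^ 'n ^ 'n \<Rightarrow> real ^ 'n \<Rightarrow> real" where
  "sq_norm_wrt H x = x \<bullet> (H *v x)"

text \<open>The supremum is taken in the extended reals, as it may be infinite.\<close>

definition minimax_objective :: "real \<Rightarrow> real ^ 'n \<Rightarrow> real ^ 'n \<Rightarrow> ereal" where
  "minimax_objective \<gamma> \<theta>hat p =
     (SUP \<theta>. ereal (MAX a\<in>std_basis.
        (mean_action p - a) \<bullet> \<theta> - \<gamma> / 4 * sq_norm_wrt (second_moment p) (\<theta>hat - \<theta>)))"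

text \<open>
  The real \<open>ln\<close> of the library satisfies \<open>ln 0 = 0\<close>; the barrier needs $\log 0 = -\infty$,
  so that the objective is $+\infty$ on the boundary of the simplex.
\<close>

definition ext_ln :: "real \<Rightarrow> ereal" where
  "ext_ln x = (if 0 < x then ereal (ln x) else -\<infinity>)"

definition log_barrier_objective :: "real \<Rightarrow> real ^ 'n \<Rightarrow> real ^ 'n \<Rightarrow> ereal" where
  "log_barrier_objective \<gamma> \<theta>hat p =
     ereal (p \<bullet> \<theta>hat) - ereal (1 / \<gamma>) * (\<Sum>i\<in>UNIV. ext_ln (p $ i))"

definition barrier_weights :: "real \<Rightarrow> real ^ 'n \<Rightarrow> real \<Rightarrow> real ^ 'n" where
  "barrier_weights \<gamma> \<theta>hat l = (\<chi> i. 1 / (l + \<gamma> * \<theta>hat $ i))"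

definition normalizing :: "real \<Rightarrow> real ^ 'n \<Rightarrow> real \<Rightarrow> bool" where
  "normalizing \<gamma> \<theta>hat l \<longleftrightarrow>
     (\<forall>i. 0 < barrier_weights \<gamma> \<theta>hat l $ i) \<and> (\<Sum>i\<in>UNIV. barrier_weights \<gamma> \<theta>hat l $ i) = 1"

definition minimizers :: "('a \<Rightarrow> ereal) \<Rightarrow> 'a set \<Rightarrow> 'a set" where
  "minimizers f S = {x. is_arg_min f (\<lambda>y. y \<in> S) x}"

end

theory Submission
  imports Defs
begin

text \<open>
  For \<open>p\<close> in the simplex with \<open>p $ k > 0\<close>, completing the square in \<open>\<theta>\<close> shows that the inner
  supremum for \<open>a = axis k 1\<close> equals $\langle p,\hat\theta\rangle - \hat\theta_k + (1/p_k - 1)/\gamma$;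
  it is infinite if \<open>p $ k = 0\<close>. For every interior \<open>p\<close>, the \<open>p\<close>-weighted average of these values
  over \<open>k\<close> is $(K-1)/\gamma$. Hence their maximum is at least $(K-1)/\gamma$, with equality iff
  $1/p_k - \gamma\hat\theta_k$ does not depend on \<open>k\<close>, that is, iff \<open>p\<close> is the vector of barrier weights.
  For the log-barrier problem, the optimality of these weights is the tangent inequality
  $\ln x \le x - 1$ at $x = p_i / w_i$, summed over \<open>i\<close>.
\<close>

lemma minimizers_eq_singletonI:
  assumes "w \<in> S" and "\<And>p. p \<in> S \<Longrightarrow> p \<noteq> w \<Longrightarrow> f w < f p"
  shows "minimizers f S = {w}"
  using assms unfolding minimizers_def is_arg_min_def by (auto dest: less_asym)

subsection \<open>The normalizing constant\<close>

lemma normalizing_pos: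
  "normalizing \<gamma> \<theta>hat l \<Longrightarrow> 0 < l + \<gamma> * \<theta>hat $ i"
  by (simp add: normalizing_def barrier_weights_def)

text \<open>While all denominators stay positive, every weight strictly decreases in the shift, so
  the total mass cannot be 1 at two different shifts.\<close>

lemma normalizing_less_False:
  assumes "normalizing \<gamma> \<theta>hat l" and "normalizing \<gamma> \<theta>hat m" and "l < m"
  shows False
proof -
  have "(\<Sum>i\<in>UNIV. 1 / (m + \<gamma> * \<theta>hat $ i)) < (\<Sum>i\<in>UNIV. 1 / (l + \<gamma> * \<theta>hat $ i))"
    using assms(3) normalizing_pos[OF assms(1)]
    by (intro sum_strict_mono) (auto intro!: divide_strict_left_mono simp: add_pos_pos
        intro: mult_pos_pos normalizing_pos[OF assms(2)])
  then show False
    using assms by (simp add: normalizing_def barrier_weights_def)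
qed

text \<open>Intermediate value theorem on \<open>{1 - m..?K - m}\<close>, where \<open>m\<close> is
  the smallest entry of \<open>\<gamma> * \<theta>hat\<close>. At the left end the minimal
  coordinate alone has weight 1; at the right end each of the K weights is at most 1/K. All
  denominators are at least 1 in between, so the mass is continuous there.\<close>

lemma normalizing_exists:
  fixes \<theta>hat :: "real ^ 'n"
  shows "\<exists>l. normalizing \<gamma> \<theta>hat l"
proof -
  define m where "m = (MIN i. \<gamma> * \<theta>hat $ i)"
  define f where "f l = (\<Sum>i\<in>UNIV. 1 / (l + \<gamma> * \<theta>hat $ i))" for l
  let ?K = "real CARD('n)"
  have m_le: "m \<le> \<gamma> * \<theta>hat $ i" for i
    unfolding m_def by (rule Min_le) auto
  have "m \<in> range (\<lambda>i. \<gamma> * \<theta>hat $ i)"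
    unfolding m_def by (rule Min_in) auto
  then obtain j where j: "m = \<gamma> * \<theta>hat $ j" by auto
  have K: "1 \<le> ?K"
    using zero_less_card_finite[where 'a='n] by linarith
  have pos: "0 < l + \<gamma> * \<theta>hat $ i" if "1 - m \<le> l" for l i
    using that m_le[of i] by linarith
  have "f (?K - m) \<le> (\<Sum>i\<in>(UNIV::'n set). 1 / ?K)"
    unfolding f_def
  proof (rule sum_mono)
    fix i :: 'n
    show "1 / (?K - m + \<gamma> * \<theta>hat $ i) \<le> 1 / ?K"
      using m_le[of i] K by (intro divide_left_mono mult_pos_pos) linarith+
  qed
  then have upper: "f (?K - m) \<le> 1" by simp
  have "1 / (1 - m + \<gamma> * \<theta>hat $ j) \<le> f (1 - m)"
    unfolding f_def by (rule member_le_sum) (auto intro: less_imp_le pos)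
  then have lower: "1 \<le> f (1 - m)" by (simp add: j)
  have "continuous_on {1 - m..?K - m} f"
    unfolding f_def using pos by (intro continuous_intros) (auto simp: less_imp_neq[symmetric])
  then obtain l where l: "1 - m \<le> l" "f l = 1"
    using IVT2'[of f "?K - m" 1 "1 - m"] upper lower K by auto
  then have "normalizing \<gamma> \<theta>hat l"
    using pos[OF l(1)] by (simp add: normalizing_def barrier_weights_def f_def)
  then show ?thesis ..
qed

lemma normalizing_ex1: "\<exists>!l. normalizing \<gamma> \<theta>hat l"
  using normalizing_exists normalizing_less_False by (metis linorder_neqE)

lemma barrier_weights_in_prob_simplex:
  "normalizing \<gamma> \<theta>hat l \<Longrightarrow> barrier_weights \<gamma> \<theta>hat l \<in> prob_simplex"
  by (auto simp: normalizing_def prob_simplex_def intro: less_imp_le)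

subsection \<open>The log-barrier problem\<close>

lemma log_barrier_objective_interior:
  assumes "\<And>i. 0 < p $ i"
  shows "log_barrier_objective \<gamma> \<theta>hat p
    = ereal (p \<bullet> \<theta>hat - (\<Sum>i\<in>UNIV. ln (p $ i)) / \<gamma>)"
  using assms by (simp add: log_barrier_objective_def ext_ln_def)

lemma log_barrier_objective_boundary:
  assumes "\<gamma> > 0" and "\<not> 0 < p $ k"
  shows "log_barrier_objective \<gamma> \<theta>hat p = \<infinity>"
proof -
  have "(\<Sum>i\<in>UNIV. ext_ln (p $ i)) = ext_ln (p $ k) + (\<Sum>i\<in>UNIV - {k}. ext_ln (p $ i))"
    by (rule sum.remove) auto
  \<comment> \<open>In \<open>ereal\<close>, adding \<open>\<infinity>\<close> to
    \<open>-\<infinity>\<close> gives \<open>\<infinity>\<close>, so this value must be ruled out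
    for the remaining terms before the sum can be evaluated.\<close>
  moreover have "(\<Sum>i\<in>UNIV - {k}. ext_ln (p $ i)) \<noteq> \<infinity>"
    by (auto simp: sum_Pinfty ext_ln_def)
  ultimately have "(\<Sum>i\<in>UNIV. ext_ln (p $ i)) = -\<infinity>"
    using assms(2) by (simp add: ext_ln_def)
  then show ?thesis
    using assms(1) by (simp add: log_barrier_objective_def)
qed

lemma ln_less_diff_one: "0 < x \<Longrightarrow> x \<noteq> 1 \<Longrightarrow> ln x < x - (1::real)"
  using ln_le_minus_one[of x] ln_eq_minus_one[of x] by linarith

lemma log_barrier_minimizers:
  fixes \<theta>hat :: "real ^ 'n"
  assumes \<gamma>: "\<gamma> > 0" and l: "normalizing \<gamma> \<theta>hat l"
  shows "minimizers (log_barrier_objective \<gamma> \<theta>hat) prob_simplex = {barrier_weights \<gamma> \<theta>hat l}"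
proof (rule minimizers_eq_singletonI)
  let ?w = "barrier_weights \<gamma> \<theta>hat l"
  show "?w \<in> prob_simplex"
    using l by (rule barrier_weights_in_prob_simplex)
  have w: "0 < ?w $ i" for i
    using l by (simp add: normalizing_def)
  \<comment> \<open>The reciprocal of a weight is \<open>l + \<gamma> * \<theta>hat $ i\<close>,
    which ties the ratios of the tangent inequality to the linear part of the objective.\<close>
  have ratio: "(\<Sum>i\<in>UNIV. q $ i / ?w $ i) = l + \<gamma> * (q \<bullet> \<theta>hat)" if "q \<in> prob_simplex" for q
  proof -
    have "(\<Sum>i\<in>UNIV. q $ i / ?w $ i) = (\<Sum>i\<in>UNIV. l * q $ i + \<gamma> * (q $ i * \<theta>hat $ i))"
      by (rule sum.cong) (auto simp: barrier_weights_def algebra_simps)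
    then show ?thesis
      using that
      by (simp add: sum.distrib inner_vec_def prob_simplex_def flip: sum_distrib_left)
  qed
  fix p :: "real ^ 'n"
  assume p: "p \<in> prob_simplex" and neq: "p \<noteq> ?w"
  show "log_barrier_objective \<gamma> \<theta>hat ?w < log_barrier_objective \<gamma> \<theta>hat p"
  proof (cases "\<forall>i. 0 < p $ i")
    case True
    obtain j where j: "p $ j \<noteq> ?w $ j"
      using neq by (auto simp: vec_eq_iff)
    have "(\<Sum>i\<in>UNIV. ln (p $ i / ?w $ i)) < (\<Sum>i\<in>UNIV. p $ i / ?w $ i - 1)"
    proof (rule sum_strict_mono_ex1)
      show "\<forall>i\<in>UNIV. ln (p $ i / ?w $ i) \<le> p $ i / ?w $ i - 1"
        using True w by (auto intro!: ln_le_minus_one)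
      have "ln (p $ j / ?w $ j) < p $ j / ?w $ j - 1"
        using True w[of j] j by (intro ln_less_diff_one) (auto simp: field_simps)
      then show "\<exists>i\<in>UNIV. ln (p $ i / ?w $ i) < p $ i / ?w $ i - 1" by blast
    qed simp
    moreover have "(\<Sum>i\<in>UNIV. ln (p $ i / ?w $ i))
        = (\<Sum>i\<in>UNIV. ln (p $ i)) - (\<Sum>i\<in>UNIV. ln (?w $ i))"
      using True w by (simp add: ln_div less_imp_neq[symmetric] flip: sum_subtractf)
    \<comment> \<open>The subtracted ones add up to K, the ratio sum of \<open>?w\<close> against
      itself; subtracting the two instances of \<open>ratio\<close> eliminates
      \<open>l\<close>.\<close>
    moreover have "(\<Sum>i\<in>UNIV. p $ i / ?w $ i - 1) = \<gamma> * (p \<bullet> \<theta>hat) - \<gamma> * (?w \<bullet> \<theta>hat)"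
    proof -
      have "(\<Sum>i\<in>UNIV. ?w $ i / ?w $ i) = (\<Sum>i\<in>(UNIV::'n set). 1)"
        using w by (intro sum.cong) (auto simp: less_imp_neq[symmetric])
      then show ?thesis
        using ratio[OF p] ratio[OF \<open>?w \<in> prob_simplex\<close>] by (simp add: sum_subtractf)
    qed
    ultimately have
      "((\<Sum>i\<in>UNIV. ln (p $ i)) - (\<Sum>i\<in>UNIV. ln (?w $ i))) / \<gamma> < p \<bullet> \<theta>hat - ?w \<bullet> \<theta>hat"
      by (subst pos_divide_less_eq[OF \<gamma>]) (simp add: algebra_simps)
    then have
      "?w \<bullet> \<theta>hat - (\<Sum>i\<in>UNIV. ln (?w $ i)) / \<gamma> < p \<bullet> \<theta>hat - (\<Sum>i\<in>UNIV. ln (p $ i)) / \<gamma>"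
      by (simp add: diff_divide_distrib)
    then show ?thesis
      using True w by (simp add: log_barrier_objective_interior)
  next
    case False
    then have "log_barrier_objective \<gamma> \<theta>hat p = \<infinity>"
      using log_barrier_objective_boundary[OF \<gamma>] by blast
    then show ?thesis
      using w by (simp add: log_barrier_objective_interior)
  qed
qed

subsection \<open>The minimax problem\<close>

lemma mean_action_eq: "mean_action p = p"
  by (simp add: mean_action_def expect_def vec_eq_iff axis_def if_distrib cong: if_cong)

lemma second_moment_nth: "second_moment p $ i $ j = (if i = j then p $ i else 0)"
proof -
  have "second_moment p $ i $ j
      = (\<Sum>k\<in>UNIV. p $ k * (axis k 1 $ i * axis k 1 $ j))"
    by (simp add: second_moment_def expect_def matrix_matrix_mult_def columnvector_def
        rowvector_def)
  also have "\<dots> = (\<Sum>k\<in>UNIV. if k = i then if i = j then p $ i else 0 else 0)"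
    by (rule sum.cong) (auto simp: axis_def)
  finally show ?thesis by simp
qed

lemma sq_norm_wrt_second_moment:
  "sq_norm_wrt (second_moment p) x = (\<Sum>i\<in>UNIV. p $ i * (x $ i)\<^sup>2)"
  by (simp add: sq_norm_wrt_def inner_vec_def matrix_vector_mult_def second_moment_nth
      if_distrib if_distribR power2_eq_square mult_ac cong: if_cong)

definition inner_value :: "real \<Rightarrow> real ^ 'n \<Rightarrow> real ^ 'n \<Rightarrow> 'n \<Rightarrow> real ^ 'n \<Rightarrow> real" where
  "inner_value \<gamma> \<theta>hat p k \<theta> =
     (p - axis k 1) \<bullet> \<theta> - \<gamma> / 4 * (\<Sum>i\<in>UNIV. p $ i * (\<theta>hat $ i - \<theta> $ i)\<^sup>2)"

text \<open>For positive \<open>\<gamma>\<close>, \<open>p\<close> in the simplex and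
  \<open>p $ k > 0\<close>, this is the maximum of \<open>inner_value\<close> over \<theta>. At
  \<open>p $ k = 0\<close> the convention 1 / 0 = 0 makes it meaningless, so the boundary is treated
  separately.\<close>

definition inner_sup :: "real \<Rightarrow> real ^ 'n \<Rightarrow> real ^ 'n \<Rightarrow> 'n \<Rightarrow> real" where
  "inner_sup \<gamma> \<theta>hat p k = p \<bullet> \<theta>hat - \<theta>hat $ k + (1 / p $ k - 1) / \<gamma>"

lemma minimax_objective_eq:
  "minimax_objective \<gamma> \<theta>hat p = (SUP \<theta>. ereal (MAX k. inner_value \<gamma> \<theta>hat p k \<theta>))"
  by (simp add: minimax_objective_def std_basis_def image_image mean_action_eq
      sq_norm_wrt_second_moment inner_value_def)

text \<open>This lower bound and the upper bound after it are all that is used about the supremum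
  below, so supremum and maximum are never exchanged.\<close>

lemma inner_value_le_minimax_objective:
  "ereal (inner_value \<gamma> \<theta>hat p k \<theta>) \<le> minimax_objective \<gamma> \<theta>hat p"
  unfolding minimax_objective_eq by (rule SUP_upper2[of \<theta>]) auto

lemma minimax_objective_leI:
  "(\<And>k \<theta>. inner_value \<gamma> \<theta>hat p k \<theta> \<le> c) \<Longrightarrow> minimax_objective \<gamma> \<theta>hat p \<le> ereal c"
  unfolding minimax_objective_eq by (auto intro!: SUP_least)

text \<open>The objective separates over coordinates, and \<open>v\<close> is the stationary point
  of the part depending on \<open>u\<close>. Dividing by \<open>p $ k\<close> instead of
  \<open>p $ i\<close> changes nothing at i = k and keeps \<open>v\<close> a stationary point where
  other entries of \<open>p\<close> vanish.\<close>

lemma inner_value_complete_square: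
  fixes p \<theta>hat u :: "real ^ 'n"
  assumes \<gamma>: "\<gamma> > 0" and p: "p \<in> prob_simplex" and pk: "p $ k > 0"
  defines "v \<equiv> \<lambda>i. 2 / \<gamma> * (1 - axis k 1 $ i / p $ k)"
  shows "inner_value \<gamma> \<theta>hat p k (\<theta>hat + u)
    = inner_sup \<gamma> \<theta>hat p k - \<gamma> / 4 * (\<Sum>i\<in>UNIV. p $ i * (u $ i - v i)\<^sup>2)"
proof -
  \<comment> \<open>The constant left by the square is
    \<open>\<gamma> / 4 * (p $ i * (v i)\<^sup>2)\<close>; at i = k it expands to p_k/\<gamma> plus
    the extra summand.\<close>
  have term_eq: "(p $ i - axis k 1 $ i) * u $ i - \<gamma> / 4 * (p $ i * (u $ i)\<^sup>2)
      + \<gamma> / 4 * (p $ i * (u $ i - v i)\<^sup>2)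
    = p $ i / \<gamma> + (if i = k then (1 / p $ k - 2) / \<gamma> else 0)" for i
  proof (cases "i = k")
    case True
    then show ?thesis
      using \<gamma> pk by (simp add: v_def power2_eq_square field_simps)
  next
    case False
    then show ?thesis
      using \<gamma> pk by (simp add: v_def axis_def power2_eq_square field_simps)
  qed
  have "(\<Sum>i\<in>UNIV. (p $ i - axis k 1 $ i) * u $ i) - \<gamma> / 4 * (\<Sum>i\<in>UNIV. p $ i * (u $ i)\<^sup>2)
      + \<gamma> / 4 * (\<Sum>i\<in>UNIV. p $ i * (u $ i - v i)\<^sup>2)
    = (\<Sum>i\<in>UNIV. p $ i / \<gamma> + (if i = k then (1 / p $ k - 2) / \<gamma> else 0))"
    by (simp only: sum_distrib_left flip: sum_subtractf sum.distrib term_eq)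
  also have "\<dots> = (1 / p $ k - 1) / \<gamma>"
    using p by (simp add: sum.distrib prob_simplex_def diff_divide_distrib flip: sum_divide_distrib)
  finally have "(\<Sum>i\<in>UNIV. (p $ i - axis k 1 $ i) * u $ i)
      - \<gamma> / 4 * (\<Sum>i\<in>UNIV. p $ i * (u $ i)\<^sup>2)
    = (1 / p $ k - 1) / \<gamma> - \<gamma> / 4 * (\<Sum>i\<in>UNIV. p $ i * (u $ i - v i)\<^sup>2)"
    by simp
  moreover have "(p - axis k 1) \<bullet> u = (\<Sum>i\<in>UNIV. (p $ i - axis k 1 $ i) * u $ i)"
    by (simp add: inner_vec_def)
  ultimately show ?thesis
    by (simp add: inner_value_def inner_sup_def inner_add_right inner_diff_left inner_axis')
qed

lemma inner_value_le_inner_sup: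
  assumes "\<gamma> > 0" and "p \<in> prob_simplex" and "p $ k > 0"
  shows "inner_value \<gamma> \<theta>hat p k \<theta> \<le> inner_sup \<gamma> \<theta>hat p k"
proof -
  have "0 \<le> (\<Sum>i\<in>UNIV. p $ i * (x i)\<^sup>2)" for x
    using assms(2) by (intro sum_nonneg) (auto simp: prob_simplex_def)
  then show ?thesis
    using inner_value_complete_square[OF assms, of \<theta>hat "\<theta> - \<theta>hat"] assms(1)
    by simp
qed

lemma inner_sup_le_minimax_objective:
  assumes "\<gamma> > 0" and "p \<in> prob_simplex" and "p $ k > 0"
  shows "ereal (inner_sup \<gamma> \<theta>hat p k) \<le> minimax_objective \<gamma> \<theta>hat p"
proof -
  \<comment> \<open>This is the stationary point \<open>v\<close>, where the completed square
    vanishes and the bound is attained.\<close>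
  let ?u = "\<chi> i. 2 / \<gamma> * (1 - axis k 1 $ i / p $ k)"
  have "inner_value \<gamma> \<theta>hat p k (\<theta>hat + ?u) = inner_sup \<gamma> \<theta>hat p k"
    using inner_value_complete_square[OF assms, of \<theta>hat ?u] by simp
  then show ?thesis
    using inner_value_le_minimax_objective[of \<gamma> \<theta>hat p k "\<theta>hat + ?u"] by simp
qed

text \<open>The quadratic penalty gives coordinate k weight zero, so moving against
  \<open>axis k 1\<close> costs nothing while the linear term grows without bound.\<close>

lemma minimax_objective_boundary:
  assumes "p $ k = 0"
  shows "minimax_objective \<gamma> \<theta>hat p = \<infinity>"
proof (rule ereal_top)
  fix B
  \<comment> \<open>A step of length \<open>t\<close> raises the value at \<open>\<theta>hat\<close>
    by \<open>t\<close>, so this choice hits \<open>B\<close> exactly.\<close>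
  define t where "t = B - (p - axis k 1) \<bullet> \<theta>hat"
  have "(\<Sum>i\<in>UNIV. p $ i * (t * axis k 1 $ i)\<^sup>2) = 0"
    using assms by (intro sum.neutral) (auto simp: axis_def)
  moreover have "(p - axis k 1) \<bullet> axis k 1 = -1"
    using assms by (simp add: inner_axis)
  ultimately have "inner_value \<gamma> \<theta>hat p k (\<theta>hat - t *\<^sub>R axis k 1) = B"
    by (simp add: inner_value_def t_def inner_diff_right)
  then show "ereal B \<le> minimax_objective \<gamma> \<theta>hat p"
    by (metis inner_value_le_minimax_objective)
qed

text \<open>The terms in \<open>\<theta>hat\<close> cancel on averaging, and p_k (1/p_k - 1) = 1 -
  p_k sums to K - 1.\<close>

lemma inner_sup_average:
  fixes p \<theta>hat :: "real ^ 'n"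
  assumes "p \<in> prob_simplex" and "\<And>i. 0 < p $ i"
  shows "(\<Sum>k\<in>UNIV. p $ k * inner_sup \<gamma> \<theta>hat p k) = (real CARD('n) - 1) / \<gamma>"
proof -
  have "(\<Sum>k\<in>UNIV. p $ k * inner_sup \<gamma> \<theta>hat p k)
      = (\<Sum>k\<in>UNIV. p $ k * (p \<bullet> \<theta>hat) - p $ k * \<theta>hat $ k + 1 / \<gamma> - p $ k / \<gamma>)"
    using less_imp_neq[OF assms(2), symmetric]
    by (intro sum.cong) (simp_all add: inner_sup_def ring_distribs diff_divide_distrib)
  then show ?thesis
    using assms(1)
    by (simp add: sum.distrib sum_subtractf inner_vec_def prob_simplex_def diff_divide_distrib
        flip: sum_distrib_right sum_divide_distrib)
qed

text \<open>At the barrier weights the dependence on k cancels; a constant equals its weighted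
  average, so its value follows without knowing \<open>l\<close>.\<close>

lemma inner_sup_barrier_weights:
  fixes \<theta>hat :: "real ^ 'n"
  assumes \<gamma>: "\<gamma> > 0" and l: "normalizing \<gamma> \<theta>hat l"
  shows "inner_sup \<gamma> \<theta>hat (barrier_weights \<gamma> \<theta>hat l) k = (real CARD('n) - 1) / \<gamma>"
proof -
  let ?w = "barrier_weights \<gamma> \<theta>hat l"
  have const: "inner_sup \<gamma> \<theta>hat ?w i = ?w \<bullet> \<theta>hat + (l - 1) / \<gamma>" for i
    using \<gamma> by (simp add: inner_sup_def barrier_weights_def field_simps)
  have "(\<Sum>i\<in>UNIV. ?w $ i * inner_sup \<gamma> \<theta>hat ?w i) = (real CARD('n) - 1) / \<gamma>"
    using l by (intro inner_sup_average barrier_weights_in_prob_simplex) (auto simp: normalizing_def)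
  moreover have "(\<Sum>i\<in>UNIV. ?w $ i) = 1"
    using l by (simp add: normalizing_def)
  ultimately show ?thesis
    by (simp add: const flip: sum_distrib_right)
qed

lemma inner_sup_const_imp_barrier_weights:
  assumes \<gamma>: "\<gamma> > 0" and l: "normalizing \<gamma> \<theta>hat l"
    and p: "p \<in> prob_simplex" "\<And>i. 0 < p $ i"
    and const: "\<And>k. inner_sup \<gamma> \<theta>hat p k = c"
  shows "p = barrier_weights \<gamma> \<theta>hat l"
proof -
  \<comment> \<open>Solving \<open>inner_sup \<gamma> \<theta>hat p k = c\<close> for 1/p_k gives
    this shift, common to all k; uniqueness of the normalizing constant then yields m = l.\<close>
  define m where "m = \<gamma> * (c - p \<bullet> \<theta>hat) + 1"
  have "1 / p $ k = m + \<gamma> * \<theta>hat $ k" for k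
    using const[of k] \<gamma> by (simp add: inner_sup_def m_def field_simps)
  then have "p $ k = 1 / (m + \<gamma> * \<theta>hat $ k)" for k
    by (metis div_by_1 divide_divide_eq_right mult_1)
  then have eq: "p = barrier_weights \<gamma> \<theta>hat m"
    by (simp add: vec_eq_iff barrier_weights_def)
  then have "normalizing \<gamma> \<theta>hat m"
    using p by (simp add: normalizing_def prob_simplex_def)
  then show ?thesis
    using eq l normalizing_ex1 by blast
qed

lemma minimax_minimizers:
  fixes \<theta>hat :: "real ^ 'n"
  assumes \<gamma>: "\<gamma> > 0" and l: "normalizing \<gamma> \<theta>hat l"
  shows "minimizers (minimax_objective \<gamma> \<theta>hat) prob_simplex = {barrier_weights \<gamma> \<theta>hat l}"
proof (rule minimizers_eq_singletonI)
  let ?w = "barrier_weights \<gamma> \<theta>hat l"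
  let ?v = "(real CARD('n) - 1) / \<gamma>"
  show w: "?w \<in> prob_simplex"
    using l by (rule barrier_weights_in_prob_simplex)
  have "0 < ?w $ i" for i
    using l by (simp add: normalizing_def)
  then have "inner_value \<gamma> \<theta>hat ?w k \<theta> \<le> ?v" for k \<theta>
    using inner_value_le_inner_sup[OF \<gamma> w, of k \<theta>hat \<theta>]
    by (simp add: inner_sup_barrier_weights[OF \<gamma> l])
  then have w_le: "minimax_objective \<gamma> \<theta>hat ?w \<le> ereal ?v"
    by (rule minimax_objective_leI)
  fix p :: "real ^ 'n"
  assume p: "p \<in> prob_simplex" and neq: "p \<noteq> ?w"
  show "minimax_objective \<gamma> \<theta>hat ?w < minimax_objective \<gamma> \<theta>hat p"
  proof (cases "\<forall>i. 0 < p $ i")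
    case True
    \<comment> \<open>Otherwise the gaps to \<open>?v\<close> are nonnegative with weighted average
      0, hence all zero because every weight is positive, and constancy forces
      \<open>p = ?w\<close>.\<close>
    have "\<exists>k. ?v < inner_sup \<gamma> \<theta>hat p k"
    proof (rule ccontr)
      assume "\<nexists>k. ?v < inner_sup \<gamma> \<theta>hat p k"
      then have le: "inner_sup \<gamma> \<theta>hat p k \<le> ?v" for k
        by (simp add: not_less)
      have nonneg: "0 \<le> p $ k * (?v - inner_sup \<gamma> \<theta>hat p k)" for k
        using le[of k] True by (intro mult_nonneg_nonneg) (simp_all add: less_imp_le)
      have "(\<Sum>k\<in>UNIV. p $ k * (?v - inner_sup \<gamma> \<theta>hat p k))
          = ?v * (\<Sum>k\<in>UNIV. p $ k) - (\<Sum>k\<in>UNIV. p $ k * inner_sup \<gamma> \<theta>hat p k)"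
        by (simp only: right_diff_distrib sum_subtractf sum_distrib_right mult.commute[of ?v])
      also have "\<dots> = 0"
        using p True by (simp add: inner_sup_average prob_simplex_def)
      finally have "\<forall>k\<in>UNIV. p $ k * (?v - inner_sup \<gamma> \<theta>hat p k) = 0"
        by (subst (asm) sum_nonneg_eq_0_iff) (use nonneg in auto)
      then have "inner_sup \<gamma> \<theta>hat p k = ?v" for k
        using True by (auto simp: less_imp_neq[symmetric])
      with inner_sup_const_imp_barrier_weights[OF \<gamma> l p] True neq show False by blast
    qed
    then obtain k where "?v < inner_sup \<gamma> \<theta>hat p k" ..
    then have "ereal ?v < ereal (inner_sup \<gamma> \<theta>hat p k)" by simp
    also have "\<dots> \<le> minimax_objective \<gamma> \<theta>hat p"
      using True by (intro inner_sup_le_minimax_objective \<gamma> p) auto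
    finally show ?thesis
      using w_le by (rule le_less_trans[rotated])
  next
    case False
    then obtain k where "p $ k = 0"
      using p by (auto simp: prob_simplex_def not_less intro: antisym)
    then show ?thesis
      using w_le by (auto simp: minimax_objective_boundary)
  qed
qed

theorem lemma1:
  fixes \<theta>hat :: "real ^ 'n" and \<gamma> :: real
  assumes "\<gamma> > 0"
  shows "(\<exists>!l. normalizing \<gamma> \<theta>hat l) \<and>
         (\<forall>l. normalizing \<gamma> \<theta>hat l \<longrightarrow>
            minimizers (minimax_objective \<gamma> \<theta>hat) prob_simplex = {barrier_weights \<gamma> \<theta>hat l} \<and>
            minimizers (log_barrier_objective \<gamma> \<theta>hat) prob_simplex = {barrier_weights \<gamma> \<theta>hat l})"
  using normalizing_ex1 minimax_minimizers[OF assms] log_barrier_minimizers[OF assms] by blast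

end
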